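(* Let $n\ge 2$ and let $\mathcal G=(\mathcal V,\mathcal E)$, $\mathcal V=\{1,\dots,n\}$, be a directed, strongly connected graph with a self-loop at every node, and let $\delta$ be its diameter. Let $W=[w_{ij}]\in\mathbb R^{n\times n}$ be a row stochastic matrix with $w_{ij}>0$ if $(j,i)\in\mathcal E$ and $w_{ij}=0$ if $(j,i)\notin\mathcal E$. Let $M=[m_{ij}]\in\mathbb R^{n\times n}$ satisfy $\|M\|_\infty=\mu<1$, let $d\in\mathbb R^n$, and let $y^*$ be the fixed point $y^*=My^*+d$, which is assumed to be the solution of the linear system $Ay=b$, where $A\in\mathbb R^{n\times n}$ is nonsingular and $b\in\mathbb R^n$. Let $\{X^k\}_{k\ge 0}\subset\mathbb R^{n^2}$ be a sequence generated, from an arbitrary $X^0\in\mathbb R^{n^2}$, by $$X^{k+1}=(W\otimes I)(\mathcal M X^k+\hat d),$$ with $\mathcal M$ and $\hat d$ built from $M$ and $d$ as described in the context, and let $X^*=(y^*;\dots;y^* )\in\mathbb R^{n^2}$. Then there exists a constant $\tau<1$ such that for every $k\ge\delta-1$ the global error $E^k=X^k-X^*$ satisfies $$\|E^{k+1}\|_\infty\le\tau\,\|E^{k-\delta+1}\|_\infty .$$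
   Context: An edge $(i,j)\in\mathcal E$ means that node $i$ can send information to node $j$. A directed graph is strongly connected if for every pair of nodes $i,j$ there is a directed path from $i$ to $j$. The distance from $i$ to $j$ is the length (number of edges) of a shortest directed path from $i$ to $j$; the diameter is the largest distance between two nodes. Construction of the iteration (DFIX method): for each $i\in\{1,\dots,n\}$, $\widehat M_i\in\mathbb R^{n\times n}$ is the matrix whose $i$-th row is the $i$-th row $(m_{i1},\dots,m_{in})$ of $M$ and whose $j$-th row, for $j\ne i$, is the $j$-th row of the identity matrix; $\widehat d_i\in\mathbb R^n$ is the vector whose $i$-th entry is $d_i$ (the $i$-th entry of $d$) and whose other entries are $0$. Then $\mathcal M=\mathrm{diag}(\widehat M_1,\dots,\widehat M_n)\in\mathbb R^{n^2\times n^2}$ (block diagonal) and $\hat d=(\widehat d_1;\dots;\widehat d_n)\in\mathbb R^{n^2}$ (stacked vectors). $I$ is the $n\times n$ identity and $\otimes$ is the Kronecker product. Writing $X^k=(x_1^k;\dots;x_n^k)$ with $x_i^k\in\mathbb R^n$ the solution estimate held by node $i$, the iteration is equivalent to $\hat x_i^{k+1}=\widehat M_i x_i^k+\widehat d_i$ and $x_i^{k+1}=\sum_{j=1}^n w_{ij}\hat x_j^{k+1}$ for all $i$. $\|\cdot\|_\infty$ is the max norm on vectors and the induced (maximum absolute row sum) norm on matrices. *)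

theory Defs
  imports "HOL-Analysis.Analysis" "Graph_Theory.Digraph_Component"
begin

definition digraph_dist :: "('a, 'b) pre_digraph \<Rightarrow> 'a \<Rightarrow> 'a \<Rightarrow> nat" where
  "digraph_dist G u v = (LEAST l. \<exists>p. pre_digraph.apath G u p v \<and> length p = l)"

text \<open>Intended for finite nonempty strongly connected digraphs, where every distance is finite.\<close>

definition digraph_diameter :: "('a, 'b) pre_digraph \<Rightarrow> nat" where
  "digraph_diameter G = Max {digraph_dist G u v | u v. u \<in> verts G \<and> v \<in> verts G}"

definition row_stochastic :: "real^'n^'n \<Rightarrow> bool" where
  "row_stochastic W \<longleftrightarrow> (\<forall>i j. 0 \<le> W $ i $ j) \<and> (\<forall>i. (\<Sum>j\<in>UNIV. W $ i $ j) = 1)"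

definition matrix_infnorm :: "real^'n^'m \<Rightarrow> real" where
  "matrix_infnorm A = Max (range (\<lambda>i. \<Sum>j\<in>UNIV. \<bar>A $ i $ j\<bar>))"

text \<open>
  A vector of length \<open>m * n\<close> made of \<open>m\<close> blocks of length \<open>n\<close> is indexed by pairs
  (block, position within the block), and likewise for the rows and columns of block matrices.
\<close>

definition stack :: "('m::finite \<Rightarrow> real^'n) \<Rightarrow> real^('m \<times> 'n)" where
  "stack x = (\<chi> p. x (fst p) $ snd p)"

definition block_diag :: "('m::finite \<Rightarrow> real^'n^'n) \<Rightarrow> real^('m \<times> 'n)^('m \<times> 'n)" where
  "block_diag B = (\<chi> p q. if fst p = fst q then B (fst p) $ snd p $ snd q else 0)"

definition kronecker :: "real^'b^'a \<Rightarrow> real^'d^'c \<Rightarrow> real^('b \<times> 'd)^('a \<times> 'c)" where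
  "kronecker A B = (\<chi> p q. A $ fst p $ fst q * B $ snd p $ snd q)"

definition M_hat :: "real^'n^'n \<Rightarrow> 'n \<Rightarrow> real^'n^'n" where
  "M_hat M i = (\<chi> r. if r = i then M $ i else mat 1 $ r)"

definition d_hat :: "real^'n \<Rightarrow> 'n \<Rightarrow> real^'n" where
  "d_hat d i = (\<chi> r. if r = i then d $ i else 0)"

lemma infnorm_cart_Max: "infnorm (x :: real^'n) = Max (range (\<lambda>i. \<bar>x $ i\<bar>))"
proof -
  have "{\<bar>x \<bullet> b\<bar> | b. b \<in> Basis} = range (\<lambda>i. \<bar>x $ i\<bar>)"
    by (auto simp: Basis_vec_def inner_axis) (metis inner_axis inner_real_def mult.right_neutral)
  then show ?thesis by (simp add: infnorm_def cSup_eq_Max)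
qed

lemma matrix_infnorm_induced:
  fixes A :: "real^'n^'m"
  shows "matrix_infnorm A = (SUP x\<in>{x. infnorm x \<le> 1}. infnorm (A *v x))"
proof (rule sym, rule cSup_eq_maximum)
  obtain i where i: "matrix_infnorm A = (\<Sum>j\<in>UNIV. \<bar>A $ i $ j\<bar>)"
  proof -
    have "matrix_infnorm A \<in> range (\<lambda>i. \<Sum>j\<in>UNIV. \<bar>A $ i $ j\<bar>)"
      unfolding matrix_infnorm_def by (rule Max_in) auto
    then show thesis using that by (rule rangeE)
  qed
  have bound: "infnorm (A *v x) \<le> matrix_infnorm A" if x: "infnorm x \<le> 1" for x
  proof -
    have xj: "\<bar>x $ j\<bar> \<le> 1" for j
      using component_le_infnorm_cart[of x j] x by linarith
    have "\<bar>(A *v x) $ r\<bar> \<le> matrix_infnorm A" for r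
    proof -
      have "\<bar>(A *v x) $ r\<bar> \<le> (\<Sum>j\<in>UNIV. \<bar>A $ r $ j * x $ j\<bar>)"
        by (simp add: matrix_vector_mult_def)
      also have "\<dots> \<le> (\<Sum>j\<in>UNIV. \<bar>A $ r $ j\<bar>)"
        by (intro sum_mono) (simp add: abs_mult xj mult_left_le)
      also have "\<dots> \<le> matrix_infnorm A" by (simp add: matrix_infnorm_def)
      finally show ?thesis .
    qed
    then show ?thesis by (simp add: infnorm_cart_Max)
  qed
  let ?x = "(\<chi> j. if A $ i $ j < 0 then -1 else 1) :: real^'n"
  have x: "infnorm ?x \<le> 1" by (simp add: infnorm_cart_Max)
  have "matrix_infnorm A = (A *v ?x) $ i"
    unfolding i matrix_vector_mult_def by (auto intro!: sum.cong)
  also have "\<dots> \<le> infnorm (A *v ?x)"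
    using component_le_infnorm_cart[of "A *v ?x" i] by linarith
  finally have "infnorm (A *v ?x) = matrix_infnorm A" using bound[OF x] by simp
  with x show "matrix_infnorm A \<in> (\<lambda>x. infnorm (A *v x)) ` {x. infnorm x \<le> 1}"
    by (metis (mono_tags, lifting) imageI mem_Collect_eq)
  show "y \<le> matrix_infnorm A" if "y \<in> (\<lambda>x. infnorm (A *v x)) ` {x. infnorm x \<le> 1}" for y
    using that bound by auto
qed

lemma block_diag_mult_stack:
  fixes B :: "'m::finite \<Rightarrow> real^'n^'n"
  shows "block_diag B *v stack x = stack (\<lambda>i. B i *v x i)"
  unfolding vec_eq_iff
proof
  fix p :: "'m \<times> 'n"
  have "(block_diag B *v stack x) $ p =
      (\<Sum>q\<in>UNIV \<times> UNIV. (if fst p = fst q then B (fst p) $ snd p $ snd q else 0) * x (fst q) $ snd q)"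
    by (simp add: matrix_vector_mult_def block_diag_def stack_def)
  also have "\<dots> = (\<Sum>i\<in>UNIV. \<Sum>j\<in>UNIV. (if fst p = i then B (fst p) $ snd p $ j else 0) * x i $ j)"
    by (simp add: sum.cartesian_product case_prod_unfold)
  also have "\<dots> = (\<Sum>i\<in>UNIV. if fst p = i then (B i *v x i) $ snd p else 0)"
    by (intro sum.cong) (auto simp: matrix_vector_mult_def)
  finally show "(block_diag B *v stack x) $ p = stack (\<lambda>i. B i *v x i) $ p"
    by (simp add: stack_def)
qed

lemma kronecker_mat_1_mult_stack:
  fixes W :: "real^'m^'m" and x :: "'m \<Rightarrow> real^'n"
  shows "kronecker W (mat 1 :: real^'n^'n) *v stack x = stack (\<lambda>i. \<Sum>j\<in>UNIV. W $ i $ j *\<^sub>R x j)"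
  unfolding vec_eq_iff
proof
  fix p :: "'m \<times> 'n"
  have "(kronecker W (mat 1 :: real^'n^'n) *v stack x) $ p =
      (\<Sum>q\<in>UNIV \<times> UNIV. W $ fst p $ fst q * (if snd p = snd q then 1 else 0) * x (fst q) $ snd q)"
    by (simp add: matrix_vector_mult_def kronecker_def stack_def mat_def)
  also have "\<dots> = (\<Sum>i\<in>UNIV. \<Sum>j\<in>UNIV. W $ fst p $ i * (if snd p = j then 1 else 0) * x i $ j)"
    by (simp add: sum.cartesian_product case_prod_unfold)
  also have "\<dots> = (\<Sum>i\<in>UNIV. W $ fst p $ i * x i $ snd p)"
    by (simp add: if_distrib if_distribR cong: if_cong)
  finally show "(kronecker W (mat 1 :: real^'n^'n) *v stack x) $ p =
      stack (\<lambda>i. \<Sum>j\<in>UNIV. W $ i $ j *\<^sub>R x j) $ p"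
    by (simp add: stack_def)
qed

lemma stack_add: "stack x + stack y = stack (\<lambda>i. x i + y i)"
  by (simp add: vec_eq_iff stack_def)

text \<open>The iteration in stacked form is the nodewise iteration.\<close>

lemma dfix_stack:
  fixes W M :: "real^'n^'n"
  shows "kronecker W (mat 1 :: real^'n^'n) *v (block_diag (M_hat M) *v stack x + stack (d_hat d)) =
    stack (\<lambda>i. \<Sum>j\<in>UNIV. W $ i $ j *\<^sub>R (M_hat M j *v x j + d_hat d j))"
  by (simp only: block_diag_mult_stack stack_add kronecker_mat_1_mult_stack)

end

theory Submission
  imports Defs
begin

text \<open>
  The step at node \<open>r\<close> contracts the \<open>r\<close>-th error component by the factor \<open>\<mu>\<close>, every other step
  is nonexpansive in the maximum norm.  A contraction factor below 1 obtained at a node is passed on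
  along each outgoing edge, because averaging with the positive weight of that edge keeps the factor
  below 1.  After as many steps as the diameter, every node has received the contraction of every
  component; self-loops pad shorter paths to that length.
\<close>

text \<open>For the contraction only the length of a path matters; relational powers keep just that
  and make padding and splitting off the last edge easy.\<close>

lemma pcas_imp_relpow:
  assumes "pcas u p v" "set p \<subseteq> R"
  shows "(u, v) \<in> R ^^ length p"
  using assms
proof (induction p arbitrary: u)
  case (Cons e p)
  then have "(u, snd e) \<in> R" by auto
  moreover have "(snd e, v) \<in> R ^^ length p" using Cons by simp
  ultimately show ?case using relpow_Suc_I2 by fastforce
qed simp

lemma relpow_pad:
  assumes "\<And>x. (x, x) \<in> R" "(x, y) \<in> R ^^ m" "m \<le> l"
  shows "(x, y) \<in> R ^^ l"
  using assms(3,2) by (induction l rule: dec_induct) (auto intro: assms(1))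

text \<open>Strong connectivity yields some path, so the \<open>LEAST\<close> in the distance is
  attained; finiteness of the node type makes the \<open>Max\<close> in the diameter an upper
  bound.\<close>

lemma
  fixes G :: "'n::finite pair_pre_digraph"
  assumes verts: "pverts G = UNIV" and sc: "strongly_connected (with_proj G)"
  shows relpow_digraph_dist: "(u, v) \<in> parcs G ^^ digraph_dist (with_proj G) u v" (is ?walk)
    and digraph_dist_le_diameter:
      "digraph_dist (with_proj G) u v \<le> digraph_diameter (with_proj G)" (is ?le)
proof -
  interpret wf_digraph "with_proj G"
    by unfold_locales (simp_all add: verts)
  have "reachable (with_proj G) u v"
    using sc verts by (auto simp: strongly_connected_def)
  then have "\<exists>l p. apath u p v \<and> length p = l"
    by (simp add: reachable_apath)
  then have "\<exists>p. apath u p v \<and> length p = digraph_dist (with_proj G) u v"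
    unfolding digraph_dist_def by (rule LeastI_ex)
  then show ?walk
    by (auto simp: apath_def awalk_def cas_with_proj_eq dest: pcas_imp_relpow)
  have "{digraph_dist (with_proj G) u v | u v. u \<in> verts (with_proj G) \<and> v \<in> verts (with_proj G)}
      = range (\<lambda>(u, v). digraph_dist (with_proj G) u v)"
    by (auto simp: verts)
  then show ?le
    unfolding digraph_diameter_def by (auto intro!: Max_ge)
qed

text \<open>Weight \<open>w i\<close> falls on a term bounded by \<open>c * N\<close>, the remaining
  \<open>1 - w i\<close> on terms bounded by \<open>N\<close>. The total
  \<open>(1 - w i * (1 - c)) * N\<close> can only grow when \<open>w i\<close> is lowered to
  \<open>\<epsilon>\<close>, since \<open>c \<le> 1\<close>.\<close>

lemma abs_weighted_average_le:
  fixes w b :: "'a \<Rightarrow> real"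
  assumes "finite S" and w: "\<And>j. j \<in> S \<Longrightarrow> 0 \<le> w j" "sum w S = 1"
    and b: "\<And>j. j \<in> S \<Longrightarrow> \<bar>b j\<bar> \<le> N"
    and i: "i \<in> S" "\<bar>b i\<bar> \<le> c * N" "c \<le> 1" "\<epsilon> \<le> w i"
  shows "\<bar>\<Sum>j\<in>S. w j * b j\<bar> \<le> (1 - \<epsilon> * (1 - c)) * N"
proof -
  have N: "0 \<le> N" using b[OF i(1)] by linarith
  have "\<bar>\<Sum>j\<in>S. w j * b j\<bar> \<le> (\<Sum>j\<in>S. w j * \<bar>b j\<bar>)"
    by (rule order_trans[OF sum_abs]) (auto simp: abs_mult w intro!: sum_mono)
  also have "\<dots> = w i * \<bar>b i\<bar> + (\<Sum>j\<in>S - {i}. w j * \<bar>b j\<bar>)"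
    using assms(1) i(1) by (rule sum.remove)
  also have "\<dots> \<le> w i * (c * N) + (\<Sum>j\<in>S - {i}. w j * N)"
    using i w b by (intro add_mono sum_mono mult_left_mono) auto
  also have "(\<Sum>j\<in>S - {i}. w j * N) = (1 - w i) * N"
    using sum.remove[OF assms(1) i(1), of w] w(2) by (simp flip: sum_distrib_right)
  also have "w i * (c * N) + (1 - w i) * N = (1 - w i * (1 - c)) * N"
    by (simp add: algebra_simps)
  also have "\<dots> \<le> (1 - \<epsilon> * (1 - c)) * N"
    using i N by (intro mult_right_mono diff_left_mono) auto
  finally show ?thesis .
qed

lemma abs_row_mult_le:
  fixes M :: "real^'n^'m"
  assumes "\<And>s. \<bar>y s\<bar> \<le> N"
  shows "\<bar>\<Sum>s\<in>UNIV. M $ r $ s * y s\<bar> \<le> matrix_infnorm M * N"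
proof -
  have "\<bar>\<Sum>s\<in>UNIV. M $ r $ s * y s\<bar> \<le> (\<Sum>s\<in>UNIV. \<bar>M $ r $ s\<bar> * N)"
    by (rule order_trans[OF sum_abs]) (auto simp: abs_mult assms intro!: sum_mono mult_left_mono)
  also have "\<dots> \<le> matrix_infnorm M * N"
    using order_trans[OF abs_ge_zero assms]
    by (auto simp: matrix_infnorm_def simp flip: sum_distrib_right intro!: mult_right_mono Max_ge)
  finally show ?thesis .
qed

lemma infnorm_cart_le_iff:
  fixes x :: "real^'n"
  shows "infnorm x \<le> c \<longleftrightarrow> (\<forall>i. \<bar>x $ i\<bar> \<le> c)"
  by (auto simp: infnorm_cart_Max)

lemma stack_surj: obtains f where "x = stack f"
proof
  show "x = stack (\<lambda>i. \<chi> r. x $ (i, r))" by (simp add: stack_def vec_eq_iff)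
qed

lemma M_hat_mult_nth:
  "(M_hat M j *v z) $ r = (if j = r then (M *v z) $ r else z $ r)"
proof -
  have "(\<Sum>s\<in>UNIV. mat 1 $ r $ s * z $ s) = z $ r"
    using matrix_vector_mul_lid[of z] by (simp add: matrix_vector_mult_def vec_eq_iff)
  then show ?thesis by (simp add: matrix_vector_mult_def M_hat_def)
qed

text \<open>Row \<open>j\<close> reproduces \<open>y\<close> by the fixed-point equation, every
  other row because it is an identity row.\<close>

lemma M_hat_fixed_point:
  assumes "y = M *v y + d"
  shows "M_hat M j *v y + d_hat d j = y"
proof -
  have "y $ r = (M *v y) $ r + d $ r" for r
    using assms by (metis vector_add_component)
  then show ?thesis by (simp add: vec_eq_iff M_hat_mult_nth d_hat_def)
qed

text \<open>Since \<open>y\<close> is fixed by every local step and by averaging, subtracting it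
  removes the affine term. Component \<open>r\<close> is altered locally only at node
  \<open>r\<close>.\<close>

lemma dfix_error_step:
  fixes W M :: "real^'n^'n" and X :: "real^('n \<times> 'n)"
  assumes fp: "y = M *v y + d" and W: "row_stochastic W"
  defines "E \<equiv> X - stack (\<lambda>_. y)"
  shows "(kronecker W (mat 1 :: real^'n^'n) *v (block_diag (M_hat M) *v X + stack (d_hat d))
      - stack (\<lambda>_. y)) $ (i, r) =
    (\<Sum>j\<in>UNIV. W $ i $ j *
      (if j = r then (\<Sum>s\<in>UNIV. M $ r $ s * E $ (j, s)) else E $ (j, r)))"
proof -
  obtain x where X: "X = stack x" by (rule stack_surj)
  have avg: "(\<Sum>j\<in>UNIV. W $ i $ j * y $ r) = y $ r"
    using W by (simp add: row_stochastic_def flip: sum_distrib_right)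
  have hat: "(M_hat M j *v x j + d_hat d j) $ r - y $ r = (M_hat M j *v (x j - y)) $ r" for j
  proof -
    have "y $ r = (M_hat M j *v y + d_hat d j) $ r" by (simp only: M_hat_fixed_point[OF fp])
    then show ?thesis by (simp add: matrix_vector_mult_diff_distrib)
  qed
  have "(kronecker W (mat 1 :: real^'n^'n) *v (block_diag (M_hat M) *v X + stack (d_hat d))
      - stack (\<lambda>_. y)) $ (i, r) =
      (\<Sum>j\<in>UNIV. W $ i $ j * ((M_hat M j *v x j + d_hat d j) $ r - y $ r))"
    unfolding X dfix_stack by (simp add: stack_def right_diff_distrib sum_subtractf avg)
  also have "\<dots> = (\<Sum>j\<in>UNIV. W $ i $ j * (M_hat M j *v (x j - y)) $ r)"
    by (simp only: hat)
  also have "\<dots> = (\<Sum>j\<in>UNIV. W $ i $ j *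
      (if j = r then (\<Sum>s\<in>UNIV. M $ r $ s * E $ (j, s)) else E $ (j, r)))"
    unfolding M_hat_mult_nth by (simp add: E_def X stack_def matrix_vector_mult_def cong: if_cong)
  finally show ?thesis .
qed

text \<open>\<open>H k j\<close> is the error at node \<open>j\<close> after its local step but before averaging.  Tracking
  \<open>H\<close> instead of \<open>E\<close> lets the induction along the walk from \<open>r\<close> start with the empty walk.\<close>

lemma averaged_error_contraction:
  fixes W M :: "real^'n^'n" and E :: "nat \<Rightarrow> real^('n \<times> 'n)"
  assumes W: "row_stochastic W" and \<epsilon>: "0 \<le> \<epsilon>" "\<epsilon> \<le> 1" "\<And>i j. (j, i) \<in> R \<Longrightarrow> \<epsilon> \<le> W $ i $ j"
    and \<mu>: "matrix_infnorm M = \<mu>" "\<mu> < 1"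
    and step: "\<And>k i r. E (Suc k) $ (i, r) = (\<Sum>j\<in>UNIV. W $ i $ j * H k j r)"
    and H: "\<And>k j r. H k j r =
      (if j = r then (\<Sum>s\<in>UNIV. M $ r $ s * E k $ (j, s)) else E k $ (j, r))"
    and walk: "(r, i) \<in> R ^^ Suc l"
  shows "\<bar>E (k + Suc l) $ (i, r)\<bar> \<le> (1 - \<epsilon> ^ Suc l * (1 - \<mu>)) * infnorm (E k)"
proof -
  have local: "\<bar>H k r r\<bar> \<le> \<mu> * infnorm (E k)" for k r
    unfolding H using abs_row_mult_le[of "\<lambda>s. E k $ (r, s)" "infnorm (E k)" M r]
    by (simp add: component_le_infnorm_cart \<mu>)
  have \<mu>_nonneg: "0 \<le> \<mu>"
    using abs_row_mult_le[of "\<lambda>_. 0" 1 M r] \<mu> by simp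
  have nonexp: "\<bar>H k j r\<bar> \<le> infnorm (E k)" for k j r
  proof (cases "j = r")
    case True
    have "\<mu> * infnorm (E k) \<le> 1 * infnorm (E k)"
      using \<mu> by (intro mult_right_mono) (auto simp: infnorm_pos_le)
    with True local[where k=k and r=r] show ?thesis by simp
  qed (simp add: H component_le_infnorm_cart)
  \<comment> \<open>The averaging bound with \<open>c = 1\<close> and \<open>\<epsilon> = 0\<close>
    is plain nonexpansiveness.\<close>
  have "infnorm (E (Suc k)) \<le> infnorm (E k)" for k
    unfolding infnorm_cart_le_iff
  proof (clarify, unfold step)
    fix i r
    show "\<bar>\<Sum>j\<in>UNIV. W $ i $ j * H k j r\<bar> \<le> infnorm (E k)"
      using abs_weighted_average_le[where S = UNIV and w = "($) (W $ i)" and b = "\<lambda>j. H k j r"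
          and N = "infnorm (E k)" and c = 1 and \<epsilon> = 0] W nonexp
      by (simp add: row_stochastic_def)
  qed
  then have mono: "infnorm (E (k + l)) \<le> infnorm (E k)" for l
    by (rule lift_Suc_antimono_le[where f = "\<lambda>k. infnorm (E k)"]) simp
  have nonexp': "\<bar>H (k + l) j r\<bar> \<le> infnorm (E k)" for l j r
    using nonexp mono order_trans by blast
  \<comment> \<open>\<open>c l\<close> is the factor after \<open>l\<close> edges from
    \<open>r\<close>: \<open>c 0 = \<mu>\<close> comes from the local step at \<open>r\<close>, and
    each edge multiplies the gap \<open>1 - c l\<close> by \<open>\<epsilon>\<close>.\<close>
  define c where "c l = 1 - \<epsilon> ^ l * (1 - \<mu>)" for l
  have c_Suc: "c (Suc l) = 1 - \<epsilon> * (1 - c l)" for l by (simp add: c_def)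
  have c_le: "c l \<le> 1" for l using \<epsilon> \<mu> by (simp add: c_def)
  have c_ge: "\<mu> \<le> c l" for l
  proof -
    have "\<epsilon> ^ l * (1 - \<mu>) \<le> 1 * (1 - \<mu>)"
      using power_le_one[OF \<epsilon>(1,2)] \<mu>(2) by (intro mult_right_mono) auto
    then show ?thesis by (simp add: c_def)
  qed
  have E_le: "\<bar>E (k + Suc l) $ (i, r)\<bar> \<le> c (Suc l) * infnorm (E k)"
    if "\<bar>H (k + l) j r\<bar> \<le> c l * infnorm (E k)" "(j, i) \<in> R" for l i j
    unfolding c_Suc add_Suc_right step
    using that W nonexp' c_le \<epsilon>
    by (intro abs_weighted_average_le[where i = j]) (auto simp: row_stochastic_def)
  have H_le: "\<bar>H (k + l) i r\<bar> \<le> c l * infnorm (E k)" if "(r, i) \<in> R ^^ l" for l i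
    using that
  proof (induction l arbitrary: i)
    case 0
    then show ?case using local by (simp add: c_def)
  next
    case (Suc l)
    then obtain j where j: "(r, j) \<in> R ^^ l" "(j, i) \<in> R" by auto
    show ?case
    proof (cases "i = r")
      case True
      \<comment> \<open>Back at \<open>r\<close>, \<open>H\<close> is not read off from the same
        entry of \<open>E\<close>, so the bound carried along the walk does not apply directly. The
        local step contracts afresh by \<open>\<mu>\<close>, which is at most
        \<open>c (Suc l)\<close>.\<close>
      have "\<bar>H (k + Suc l) r r\<bar> \<le> \<mu> * infnorm (E (k + Suc l))" by (rule local)
      also have "\<dots> \<le> c (Suc l) * infnorm (E k)"
        by (intro mult_mono c_ge mono order_trans[OF \<mu>_nonneg c_ge] infnorm_pos_le)
      finally show ?thesis using True by simp
    next
      case False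
      then show ?thesis using E_le[OF Suc.IH[OF j(1)] j(2)] by (simp add: H)
    qed
  qed
  \<comment> \<open>The last edge is used by the averaging that turns \<open>H\<close> into
    \<open>E\<close>, so \<open>Suc l\<close> edges match \<open>Suc l\<close> iterations.\<close>
  from walk obtain j where "(r, j) \<in> R ^^ l" "(j, i) \<in> R" by auto
  then show ?thesis using E_le[OF H_le] unfolding c_def by blast
qed

theorem theorem1:
  fixes G :: "'n::finite pair_pre_digraph"
    and W M A :: "real^'n^'n"
    and d b ystar :: "real^'n"
    and \<mu> :: real
    and X :: "nat \<Rightarrow> real^('n \<times> 'n)"
  assumes "CARD('n) \<ge> 2"
    and "pverts G = UNIV"
    and "strongly_connected (with_proj G)"
    and "\<And>i. (i, i) \<in> parcs G"
    and "row_stochastic W"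
    and "\<And>i j. (j, i) \<in> parcs G \<Longrightarrow> W $ i $ j > 0"
    and "\<And>i j. (j, i) \<notin> parcs G \<Longrightarrow> W $ i $ j = 0"
    and "matrix_infnorm M = \<mu>" and "\<mu> < 1"
    and "ystar = M *v ystar + d"
    and "invertible A" and "A *v ystar = b"
    and "\<And>k. X (k + 1) =
           kronecker W (mat 1 :: real^'n^'n) *v (block_diag (M_hat M) *v X k + stack (d_hat d))"
  shows "\<exists>\<tau><1. \<forall>k. k + 1 \<ge> digraph_diameter (with_proj G) \<longrightarrow>
           infnorm (X (k + 1) - stack (\<lambda>_. ystar))
             \<le> \<tau> * infnorm (X (k + 1 - digraph_diameter (with_proj G)) - stack (\<lambda>_. ystar))"
proof -
  let ?G = "with_proj G"
  let ?E = "\<lambda>k. X k - stack (\<lambda>_. ystar)"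
  define H where "H k j r =
    (if j = r then (\<Sum>s\<in>UNIV. M $ r $ s * ?E k $ (j, s)) else ?E k $ (j, r))" for k j r
  have step: "?E (Suc k) $ (i, r) = (\<Sum>j\<in>UNIV. W $ i $ j * H k j r)" for k i r
    using dfix_error_step[OF assms(10,5), of "X k" i r] assms(13)[of k] by (simp add: H_def)
  \<comment> \<open>A lower bound for the weights that is uniform over all edges, positive because
    the edges are finitely many.\<close>
  define \<epsilon> where "\<epsilon> = Min ((\<lambda>(j, i). W $ i $ j) ` parcs G)"
  have ne: "parcs G \<noteq> {}" using assms(4) by blast
  have \<epsilon>_pos: "0 < \<epsilon>"
    unfolding \<epsilon>_def using ne assms(6) by (subst Min_gr_iff) auto
  have \<epsilon>_le: "\<epsilon> \<le> W $ i $ j" if "(j, i) \<in> parcs G" for i j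
    unfolding \<epsilon>_def using that by (intro Min_le) auto
  \<comment> \<open>Together with a self-loop this bounds \<open>\<epsilon>\<close> by 1, which
    keeps its powers at most 1.\<close>
  have "W $ i $ j \<le> (\<Sum>j\<in>UNIV. W $ i $ j)" for i j
    using assms(5) by (intro member_le_sum) (auto simp: row_stochastic_def)
  then have "\<epsilon> \<le> 1"
    using \<epsilon>_le assms(4,5) order_trans unfolding row_stochastic_def by metis
  define \<delta> where "\<delta> = digraph_diameter ?G"
  \<comment> \<open>Two distinct nodes force a positive diameter; with diameter 0 the claim would
    compare an error with itself.\<close>
  obtain u v :: 'n where "u \<noteq> v"
    using assms(1) by (metis UNIV_I card_2_iff' card_le_Suc0_iff_eq finite not_less_eq_eq numeral_2_eq_2)
  then have "digraph_dist ?G u v \<noteq> 0"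
    using relpow_digraph_dist[OF assms(2,3), of u v] by (auto intro: gr0I)
  then obtain l where l: "\<delta> = Suc l"
    using digraph_dist_le_diameter[OF assms(2,3), of u v] not0_implies_Suc unfolding \<delta>_def by fastforce
  have walk: "(r, i) \<in> parcs G ^^ \<delta>" for r i
    unfolding \<delta>_def
    using relpow_pad[OF assms(4)] relpow_digraph_dist[OF assms(2,3)]
      digraph_dist_le_diameter[OF assms(2,3)] by blast
  have "infnorm (?E (k + \<delta>)) \<le> (1 - \<epsilon> ^ \<delta> * (1 - \<mu>)) * infnorm (?E k)" for k
    unfolding infnorm_cart_le_iff
  proof clarify
    fix i r
    show "\<bar>?E (k + \<delta>) $ (i, r)\<bar> \<le> (1 - \<epsilon> ^ \<delta> * (1 - \<mu>)) * infnorm (?E k)"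
      using averaged_error_contraction[where E = ?E and H = H and R = "parcs G" and l = l,
        OF assms(5) less_imp_le[OF \<epsilon>_pos] \<open>\<epsilon> \<le> 1\<close> \<epsilon>_le assms(8,9) step H_def] walk l
      by simp
  qed
  \<comment> \<open>Reindexing by \<open>k + 1 - \<delta>\<close>; the condition on \<open>k\<close>
    keeps the natural-number subtraction from truncating.\<close>
  then have "infnorm (?E (k + 1)) \<le> (1 - \<epsilon> ^ \<delta> * (1 - \<mu>)) * infnorm (?E (k + 1 - \<delta>))"
    if "k + 1 \<ge> \<delta>" for k
    using that by (metis le_add_diff_inverse2)
  moreover have "1 - \<epsilon> ^ \<delta> * (1 - \<mu>) < 1"
    using \<epsilon>_pos assms(9) by simp
  ultimately show ?thesis unfolding \<delta>_def by blast
qed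

end
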